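(* Let $q=p^e$ be a prime power, $g$ a positive divisor of $q-1$, and $n$ a positive integer coprime to $q$. Write $g=g_1^{e_1}\cdots g_u^{e_u}$ and $n=g_1^{f_1}\cdots g_u^{f_u}p_1^{j_1}\cdots p_s^{j_s}$, where $g_1,\dots,g_u,p_1,\dots,p_s$ are pairwise distinct primes different from $p$, $g_1<\cdots<g_u$, $p_1<\cdots<p_s$, the $e_k$ and $j_k$ are positive integers and the $f_k$ are nonnegative integers. Put $n_1=g_1^{f_1}\cdots g_u^{f_u}$. Then for every $\mathbf{x}\in[0,g_1^{y_1}-1]\times\cdots\times[0,g_u^{y_u}-1]$ and every $I=(\mathfrak{m},\mathfrak{a},\mathfrak{t})\in\mathcal{I}_{ng/n_1g}(\gamma_{\mathbf{x}})$, the size of the $q$-cyclotomic coset $c_{ng}(\gamma_{\mathbf{x},I})$ is $\tau_s(\mathfrak{m})$.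
   Context: Notation: $\mathbb{N}=\{0,1,\dots\}$; $[a,b]$ is the set of integers from $a$ to $b$; $v_\ell$ is the $\ell$-adic valuation; $\overline{[0,j_k-1]}=[0,j_k-1]\cup\{\infty\}$. The cases $u=0$ ($g=1$) and $s=0$ are allowed, with empty products equal to $1$ and empty tuples. For $M\geq1$ coprime to $q$, the $q$-cyclotomic coset modulo $M$ containing $\gamma$ is $c_M(\gamma)=\{\gamma,\gamma q,\dots,\gamma q^{\tau-1}\}\subseteq\mathbb{Z}/M\mathbb{Z}$, $\tau$ being the least positive integer with $\gamma q^\tau\equiv\gamma\pmod M$; its size is $\tau$. The exponents $y_k$ and integers $\gamma_{\mathbf{x}}$. If $g_1=2$ and $q\equiv3\pmod4$, $y_1=\max\{0,\min\{f_1-1,v_{g_1}(q+1)-e_1\}\}$; otherwise $y_1=\min\{f_1,v_{g_1}(q-1)-e_1\}$. For $2\leq k\leq u$, $y_k=\min\{f_k,v_{g_k}(q-1)-e_k\}$. For $\mathbf{x}=(x_1,\dots,x_u)$ with $x_k\in[0,g_k^{y_k}-1]$: $\gamma_{\mathbf{x}}=1+g(g_1x_1+g_1^{f_1}x_2+\cdots+g_1^{f_1}\cdots g_{u-1}^{f_{u-1}}x_u)$ if $g_1=2$ and $q\equiv3\pmod4$, and $\gamma_{\mathbf{x}}=1+g(x_1+g_1^{f_1}x_2+\cdots+g_1^{f_1}\cdots g_{u-1}^{f_{u-1}}x_u)$ otherwise. The general construction below is applied with base modulus $N_0=n_1g$, $\gamma=\gamma_{\mathbf{x}}$ and $n'=p_1^{j_1}\cdots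 p_s^{j_s}$ (so $N_0n'=ng$ and $\tau=|c_{n_1g}(\gamma_{\mathbf{x}})|$); $\gamma_{\mathbf{x},I}:=(\gamma_{\mathbf{x}})_I$. For $s=0$, $\mathcal{I}$ has one element $I$, $\gamma_I=\gamma$ and $\tau_0=\tau$. Let $N_0$ be a positive integer coprime to $q$ and to $p_1\cdots p_s$, $\gamma\in\mathbb{Z}$, $\tau=|c_{N_0}(\gamma)|$. For $\mathfrak{m}=(m_1,\dots,m_s)$ with $m_k\in\overline{[0,j_k-1]}$, write $\mathfrak{m}_{\leq k}=(m_1,\dots,m_k)$ and define recursively: $\bullet$ $k=1$: $r_1=[(\mathbb{Z}/p_1\mathbb{Z})^*:\langle q^\tau\rangle]$; $v_1=v_2(q^\tau+1)$ if $p_1=2$ and $q^\tau\equiv3\pmod4$, and $v_1=v_{p_1}(q^{\tau(p_1-1)/r_1}-1)$ otherwise. If $p_1=2$ and $q^\tau\equiv3\pmod 4$: $\tau_1(\mathfrak{m}_{\leq1})=\tau$ if $m_1\in\{j_1-1,\infty\}$ and $2^{\max\{1,j_1-m_1-v_1\}}\tau$ if $0\leq m_1\leq j_1-2$. Otherwise: $\tau_1(\mathfrak{m}_{\leq1})=\tau$ if $m_1=\infty$ and $p_1^{\max\{0,j_1-m_1-v_1\}}\frac{p_1-1}{r_1}\tau$ if $0\leq m_1\leq j_1-1$. $\bullet$ $2\leq k\leq s$: $r_k(\mathfrak{m}_{\leq k-1})=[(\mathbb{Z}/p_k\mathbb{Z})^*:\langle q^{\tau_{k-1}(\mathfrak{m}_{\leq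 k-1})}\rangle]$, $\widetilde\tau_k=\frac{\tau_{k-1}(\mathfrak{m}_{\leq k-1})(p_k-1)}{r_k(\mathfrak{m}_{\leq k-1})}$, $v_k(\mathfrak{m}_{\leq k-1})=v_{p_k}(q^{\widetilde\tau_k}-1)$; $\tau_k(\mathfrak{m}_{\leq k})=\tau_{k-1}(\mathfrak{m}_{\leq k-1})$ if $m_k=\infty$, and $\tau_k(\mathfrak{m}_{\leq k})=p_k^{\max\{0,j_k-m_k-v_k(\mathfrak{m}_{\leq k-1})\}}\frac{p_k-1}{r_k(\mathfrak{m}_{\leq k-1})}\tau_{k-1}(\mathfrak{m}_{\leq k-1})$ if $0\leq m_k\leq j_k-1$. Index set. $\mathcal{I}_{N_0n'/N_0}(\gamma)$ is the set of triples $(\mathfrak{m},\mathfrak{a},\mathfrak{t})$ with $\mathfrak{m}\in\overline{[0,j_1-1]}\times\cdots\times\overline{[0,j_s-1]}$ and $\mathfrak{a},\mathfrak{t}\in\mathbb{N}^s$ such that: (i) for every $k$, if $m_k=\infty$ then $a_k=t_k=0$; (ii) if $m_1\in[0,j_1-1]$: when $p_1=2$ and $q^\tau\equiv3\pmod4$, $a_1=1$ and $t_1\in[0,2^{\max\{0,\min\{v_1-1,j_1-m_1-2\}\}}-1]$; otherwise $a_1\in[1,r_1]$ and $t_1\in[0,p_1^{\min\{v_1,j_1-m_1\}-1}-1]$; (iii) for $2\leq k\leq s$, if $m_k\in[0,j_k-1]$ then $a_k\in[1,r_k(\mathfrak{m}_{\leq k-1})]$ and $t_k\in[0,p_k^{\min\{v_k(\mathfrak{m}_{\leq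 k-1}),j_k-m_k\}-1}-1]$. The integers $\varphi$ and $U$. For a positive integer $B$, a prime $\ell\nmid B$, $\ell\neq p$, and $\delta\in\mathbb{Z}$, let $\varphi_B^\ell(\delta)=-\delta/B=\sum_{k\geq0}\phi_k\ell^k\in\mathbb{Z}_\ell$ ($\phi_k\in[0,\ell-1]$) and $\varphi_B^\ell(\delta)_{\leq i}=\sum_{k=0}^i\phi_k\ell^k$. Let $\theta$ be the size of $c_B(\delta)$ and $r=[(\mathbb{Z}/\ell\mathbb{Z})^*:\langle q^\theta\rangle]$. For $m\in\mathbb{N}$, $a\in[1,r]$, put $U_B^\ell(\delta;m,a)=\sum_{k=0}^{m-1}\phi_k\ell^k+u\,\ell^m$, where: if $\ell\mid q^\theta-1$ (so $r=\ell-1$), $u=\sigma^m_a$ with $[0,\ell-1]\setminus\{\phi_m\}=\{\sigma_1^m<\cdots<\sigma_{\ell-1}^m\}$; if $\ell\nmid q^\theta-1$, $u\in[0,\ell-1]$ with $u\equiv\phi_m+\sigma_a\pmod\ell$, where $\{\sigma_1<\dots<\sigma_r\}\subseteq[1,\ell-1]$ is a fixed full set of representatives of $(\mathbb{Z}/\ell\mathbb{Z})^*/\langle q^\theta\rangle$. For $\ell=2$ write $U_B^2(\delta;m)=U_B^2(\delta;m,1)=\sum_{k<m}\phi_k2^k+(1-\phi_m)2^m$. The representative $\gamma_I$. For $I=(\mathfrak{m},\mathfrak{a},\mathfrak{t})$ put $\gamma_I=\gamma_{I,s}$, where: $\bullet$ $\gamma_{I,1}=\gamma+N_0\,\varphi_{N_0}^{p_1}(\gamma)_{\leq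 j_1-1}$ if $m_1=\infty$; $\gamma_{I,1}=\gamma+N_0(U_{N_0}^2(\gamma;m_1)+2^{m_1+2}t_1)$ if $0\leq m_1\leq j_1-1$, $p_1=2$ and $q^\tau\equiv3\pmod4$; $\gamma_{I,1}=\gamma+N_0(U_{N_0}^{p_1}(\gamma;m_1,a_1)+p_1^{m_1+1}t_1)$ otherwise. $\bullet$ For $2\leq k\leq s$, with $B_k=p_1^{j_1}\cdots p_{k-1}^{j_{k-1}}N_0$: $\gamma_{I,k}=\gamma_{I,k-1}+B_k\,\varphi_{B_k}^{p_k}(\gamma_{I,k-1})_{\leq j_k-1}$ if $m_k=\infty$; $\gamma_{I,k}=\gamma_{I,k-1}+B_k\bigl(U_{B_k}^{p_k}(\gamma_{I,k-1};m_k,a_k)+p_k^{m_k+1}t_k\bigr)$ if $0\leq m_k\leq j_k-1$. (Here the size $\theta$ of $c_{B_k}(\gamma_{I,k-1})$ used in forming $U$ is $\tau_{k-1}(\mathfrak{m}_{\leq k-1})$.) *)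

theory Defs
  imports
    "HOL-Number_Theory.Number_Theory"
    "HOL-Algebra.Generated_Groups"
    "HOL-Library.Extended_Nat"
    "HOL-Library.FuncSet"
begin

text \<open>
  Tuples \<open>(z_1, ..., z_k)\<close> are functions on \<open>nat\<close> that are only evaluated on \<open>{1..k}\<close>; sets of
  tuples are extensional products over \<open>{1..k}\<close>. The value \<open>\<infinity>\<close> of an entry of \<open>m\<close> is that of type
  \<open>enat\<close>.
\<close>

text \<open>Elements of \<open>Z/MZ\<close> are represented by their residues in \<open>{0..<M}\<close>.\<close>

definition cyc_coset :: "nat \<Rightarrow> nat \<Rightarrow> int \<Rightarrow> int set" where
  "cyc_coset q M \<gamma> =
     (\<lambda>i. (\<gamma> * int q ^ i) mod int M) ` {..< LEAST t. t > 0 \<and> [\<gamma> * int q ^ t = \<gamma>] (mod int M)}"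

definition unit_group :: "nat \<Rightarrow> int monoid" where
  "unit_group l = units_of (residue_ring (int l))"

definition cyc_subgroup :: "nat \<Rightarrow> nat \<Rightarrow> int set" where
  "cyc_subgroup l x = generate (unit_group l) {int x mod int l}"

definition unit_index :: "nat \<Rightarrow> nat \<Rightarrow> nat" where
  "unit_index l x = card (rcosets\<^bsub>unit_group l\<^esub> (cyc_subgroup l x))"

definition full_reps :: "nat \<Rightarrow> nat \<Rightarrow> nat set \<Rightarrow> bool" where
  "full_reps l x S \<longleftrightarrow> S \<subseteq> {1..l - 1} \<and>
     (\<forall>C \<in> rcosets\<^bsub>unit_group l\<^esub> (cyc_subgroup l x). \<exists>!\<sigma>. \<sigma> \<in> S \<and> int \<sigma> \<in> C)"

text \<open>
  The condition \<open>g_1 = 2\<close> presupposes \<open>u \<ge> 1\<close>. The maximum with 0 in the exceptional case of \<open>y_1\<close>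
  is realised by truncated subtraction.
\<close>

definition g_exceptional :: "nat \<Rightarrow> nat \<Rightarrow> (nat \<Rightarrow> nat) \<Rightarrow> bool" where
  "g_exceptional q u gs \<longleftrightarrow> u \<ge> 1 \<and> gs 1 = 2 \<and> [q = 3] (mod 4)"

definition y_exp ::
    "nat \<Rightarrow> nat \<Rightarrow> (nat \<Rightarrow> nat) \<Rightarrow> (nat \<Rightarrow> nat) \<Rightarrow> (nat \<Rightarrow> nat) \<Rightarrow> nat \<Rightarrow> nat" where
  "y_exp q u gs e f k =
     (if k = 1 \<and> g_exceptional q u gs
      then min (f 1 - 1) (multiplicity (gs 1) (q + 1) - e 1)
      else min (f k) (multiplicity (gs k) (q - 1) - e k))"

definition gamma_x ::
    "nat \<Rightarrow> nat \<Rightarrow> nat \<Rightarrow> (nat \<Rightarrow> nat) \<Rightarrow> (nat \<Rightarrow> nat) \<Rightarrow> (nat \<Rightarrow> nat) \<Rightarrow> int" where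
  "gamma_x q g u gs f x =
     1 + int g * int (\<Sum>k = 1..u. (if k = 1 \<and> g_exceptional q u gs then gs 1 else 1) *
                                  (\<Prod>i = 1..<k. gs i ^ f i) * x k)"

text \<open>
  The argument \<open>t\<close> of the first two definitions stands for \<open>\<tau>_(k-1)(m)\<close>, with \<open>\<tau>_0 = \<tau>\<close>. Apart from
  the exceptional case, the formulas for \<open>k = 1\<close> are those for \<open>k \<ge> 2\<close>.
  The terms \<open>max {0, ...}\<close> are again truncated subtractions. By construction, \<open>tau_seq q p j \<tau> m k\<close>
  depends on \<open>m 1, ..., m k\<close> only.
\<close>

definition p_exceptional :: "nat \<Rightarrow> (nat \<Rightarrow> nat) \<Rightarrow> nat \<Rightarrow> nat \<Rightarrow> bool" where
  "p_exceptional q p k t \<longleftrightarrow> k = 1 \<and> p 1 = 2 \<and> [q ^ t = 3] (mod 4)"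

definition v_exp :: "nat \<Rightarrow> (nat \<Rightarrow> nat) \<Rightarrow> nat \<Rightarrow> nat \<Rightarrow> nat" where
  "v_exp q p k t =
     (if p_exceptional q p k t then multiplicity 2 (q ^ t + 1)
      else multiplicity (p k) (q ^ (t * (p k - 1) div unit_index (p k) (q ^ t)) - 1))"

primrec tau_seq ::
    "nat \<Rightarrow> (nat \<Rightarrow> nat) \<Rightarrow> (nat \<Rightarrow> nat) \<Rightarrow> nat \<Rightarrow> (nat \<Rightarrow> enat) \<Rightarrow> nat \<Rightarrow> nat" where
  "tau_seq q p j \<tau> m 0 = \<tau>"
| "tau_seq q p j \<tau> m (Suc k) =
     (let t = tau_seq q p j \<tau> m k; l = p (Suc k); v = v_exp q p (Suc k) t in
      case m (Suc k) of
        \<infinity> \<Rightarrow> t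
      | enat \<mu> \<Rightarrow>
          if p_exceptional q p (Suc k) t
          then (if \<mu> = j 1 - 1 then t else 2 ^ max 1 (j 1 - \<mu> - v) * t)
          else l ^ (j (Suc k) - \<mu> - v) * ((l - 1) div unit_index l (q ^ t)) * t)"

definition index_set ::
    "nat \<Rightarrow> nat \<Rightarrow> (nat \<Rightarrow> nat) \<Rightarrow> (nat \<Rightarrow> nat) \<Rightarrow> nat \<Rightarrow>
     ((nat \<Rightarrow> enat) \<times> (nat \<Rightarrow> nat) \<times> (nat \<Rightarrow> nat)) set" where
  "index_set q s p j \<tau> =
     {(m, a, t).
        m \<in> (\<Pi>\<^sub>E k\<in>{1..s}. insert \<infinity> (enat ` {0..j k - 1})) \<and>
        a \<in> {1..s} \<rightarrow>\<^sub>E UNIV \<and> t \<in> {1..s} \<rightarrow>\<^sub>E UNIV \<and>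
        (\<forall>k\<in>{1..s}. m k = \<infinity> \<longrightarrow> a k = 0 \<and> t k = 0) \<and>
        (\<forall>k\<in>{1..s}. \<forall>\<mu>. m k = enat \<mu> \<longrightarrow>
           (let t' = tau_seq q p j \<tau> m (k - 1); v = v_exp q p k t' in
            if p_exceptional q p k t'
            then a k = 1 \<and> t k \<in> {0..2 ^ min (v - 1) (j k - \<mu> - 2) - 1}
            else a k \<in> {1..unit_index (p k) (q ^ t')} \<and>
                 t k \<in> {0..p k ^ (min v (j k - \<mu>) - 1) - 1}))}"

text \<open>
  \<open>\<phi>\<close> is the digit sequence of \<open>-\<delta>/B\<close> in the inverse limit \<open>Z_l\<close> of the rings \<open>Z/l^nZ\<close>: the image of
  \<open>B * (\<Sum>k. \<phi> k * l^k)\<close> in \<open>Z/l^nZ\<close> is that of \<open>-\<delta>\<close>, for every \<open>n\<close>.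
\<close>

definition is_ladic_expansion :: "nat \<Rightarrow> nat \<Rightarrow> int \<Rightarrow> (nat \<Rightarrow> nat) \<Rightarrow> bool" where
  "is_ladic_expansion B l \<delta> \<phi> \<longleftrightarrow>
     (\<forall>k. \<phi> k \<in> {0..l - 1}) \<and>
     (\<forall>n. [int B * int (\<Sum>k<n. \<phi> k * l ^ k) = - \<delta>] (mod int l ^ n))"

definition ladic_digit :: "nat \<Rightarrow> nat \<Rightarrow> int \<Rightarrow> nat \<Rightarrow> nat" where
  "ladic_digit B l \<delta> = (THE \<phi>. is_ladic_expansion B l \<delta> \<phi>)"

lemma digit_sum_less:
  fixes l :: nat
  assumes "\<And>k. \<phi> k < l"
  shows "(\<Sum>k<n. \<phi> k * l ^ k) < l ^ n"
proof (induction n)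
  case (Suc n)
  have "(\<Sum>k<Suc n. \<phi> k * l ^ k) < l ^ n + \<phi> n * l ^ n"
    using Suc.IH by simp
  also have "\<dots> = Suc (\<phi> n) * l ^ n" by simp
  also have "\<dots> \<le> l * l ^ n"
    using assms[of n] by (intro mult_right_mono) auto
  finally show ?case by simp
qed simp

lemma ex1_ladic_expansion:
  assumes "prime l" "\<not> l dvd B"
  shows "\<exists>!\<phi>. is_ladic_expansion B l \<delta> \<phi>"
proof -
  have l: "l \<ge> 2" using assms(1) by (rule prime_ge_2_nat)
  have cop: "coprime (int B) (int l ^ n)" for n
    using assms prime_imp_coprime[of l B] by (simp add: coprime_commute)
  have uniq: "x = y"
    if "[int B * int x = - \<delta>] (mod int l ^ n)" "[int B * int y = - \<delta>] (mod int l ^ n)"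
       "x < l ^ n" "y < l ^ n" for x y n
  proof -
    have "[int B * int x = int B * int y] (mod int l ^ n)"
      using that(1,2) cong_sym cong_trans by blast
    then have "[int x = int y] (mod int (l ^ n))"
      using cop[of n] by (simp add: cong_mult_lcancel)
    then have "[x = y] (mod l ^ n)" by (simp only: cong_int_iff)
    then show ?thesis using that(3,4) by (simp add: cong_less_modulus_unique_nat)
  qed
  have "\<exists>x. x < l ^ n \<and> [int B * int x = - \<delta>] (mod int l ^ n)" for n
  proof -
    obtain b where b: "[int B * b = 1] (mod int l ^ n)"
      using cong_solve_coprime_int[OF cop[of n]] by blast
    define x where "x = nat ((b * - \<delta>) mod int l ^ n)"
    have pos: "int l ^ n > 0" using l by simp
    have x: "int x = (b * - \<delta>) mod int l ^ n"
      using pos by (simp add: x_def)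
    have "int x < int (l ^ n)"
      using pos by (simp add: x)
    moreover have "[int B * int x = int B * b * - \<delta>] (mod int l ^ n)"
      by (simp add: x cong_def mod_mult_right_eq mult.assoc)
    moreover have "[int B * b * - \<delta> = 1 * - \<delta>] (mod int l ^ n)"
      using b by (rule cong_scalar_right)
    ultimately show ?thesis
      by (metis cong_trans mult_1 of_nat_less_iff)
  qed
  then obtain X where X: "\<And>n. X n < l ^ n"
      "\<And>n. [int B * int (X n) = - \<delta>] (mod int l ^ n)"
    by metis
  have step: "X (Suc n) mod l ^ n = X n" for n
  proof (rule uniq)
    have "[int B * int (X (Suc n)) = - \<delta>] (mod int l ^ n)"
      by (rule cong_dvd_modulus[OF X(2)[of "Suc n"]]) simp
    moreover have "[int B * int (X (Suc n) mod l ^ n) = int B * int (X (Suc n))] (mod int l ^ n)"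
      by (simp add: cong_def zmod_int mod_mult_right_eq)
    ultimately show "[int B * int (X (Suc n) mod l ^ n) = - \<delta>] (mod int l ^ n)"
      using cong_trans by blast
  qed (use X l in auto)
  define \<phi> where "\<phi> k = X (Suc k) div l ^ k" for k
  have sumX: "(\<Sum>k<n. \<phi> k * l ^ k) = X n" for n
  proof (induction n)
    case 0
    then show ?case using X(1)[of 0] by simp
  next
    case (Suc n)
    have "(\<Sum>k<Suc n. \<phi> k * l ^ k) = X (Suc n) mod l ^ n + X (Suc n) div l ^ n * l ^ n"
      using Suc.IH by (simp add: \<phi>_def step)
    also have "\<dots> = X (Suc n)" by (rule mod_div_mult_eq)
    finally show ?case .
  qed
  have lt_phi: "\<phi> k < l" for k
    using X(1)[of "Suc k"] l by (simp add: \<phi>_def less_mult_imp_div_less)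
  have "\<phi> k \<in> {0..l - 1}" for k
    using lt_phi[of k] by simp
  then have ex: "is_ladic_expansion B l \<delta> \<phi>"
    using X(2) by (simp add: is_ladic_expansion_def sumX)
  have "\<psi> = \<phi>" if "is_ladic_expansion B l \<delta> \<psi>" for \<psi>
  proof
    fix n
    have "\<psi> k \<le> l - 1" for k
      using that by (simp add: is_ladic_expansion_def)
    then have lt: "\<psi> k < l" for k
      using l by (metis Suc_pred' less_Suc_eq_le less_le_trans pos2)
    have s: "(\<Sum>k<n. \<psi> k * l ^ k) = X n" for n
      by (rule uniq[of _ n]) (use that X digit_sum_less[of \<psi> l n, OF lt] in
          \<open>simp_all only: is_ladic_expansion_def\<close>)
    have "\<psi> n * l ^ n = \<phi> n * l ^ n"
      using s[of "Suc n"] s[of n] sumX[of "Suc n"] sumX[of n]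
      by (metis add_left_cancel sum.lessThan_Suc)
    then show "\<psi> n = \<phi> n" using l by simp
  qed
  with ex show ?thesis by blast
qed

text \<open>
  \<open>S B l \<delta>\<close> is the fixed set of representatives used for the data \<open>B\<close>, \<open>l\<close>, \<open>\<delta>\<close>. The list indices are
  shifted by one because lists are indexed from 0. For \<open>l = 2\<close>, the only element of \<open>{0..1} - {\<phi>_m}\<close>
  is \<open>1 - \<phi>_m\<close>, so that \<open>U_int q S B 2 \<delta> m 1\<close> is the integer \<open>U_B^2(\<delta>; m)\<close>.
\<close>

definition U_int ::
    "nat \<Rightarrow> (nat \<Rightarrow> nat \<Rightarrow> int \<Rightarrow> nat set) \<Rightarrow> nat \<Rightarrow> nat \<Rightarrow> int \<Rightarrow> nat \<Rightarrow> nat \<Rightarrow> nat" where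
  "U_int q S B l \<delta> m a =
     (let \<phi> = ladic_digit B l \<delta>; \<theta> = card (cyc_coset q B \<delta>);
          u = (if l dvd q ^ \<theta> - 1 then sorted_list_of_set ({0..l - 1} - {\<phi> m}) ! (a - 1)
               else (\<phi> m + sorted_list_of_set (S B l \<delta>) ! (a - 1)) mod l)
      in (\<Sum>k<m. \<phi> k * l ^ k) + u * l ^ m)"

definition reps_choice :: "nat \<Rightarrow> nat \<Rightarrow> (nat \<Rightarrow> nat \<Rightarrow> int \<Rightarrow> nat set) \<Rightarrow> bool" where
  "reps_choice p q S \<longleftrightarrow>
     (\<forall>B l \<delta>. B > 0 \<and> coprime B q \<and> prime l \<and> \<not> l dvd B \<and> l \<noteq> p \<and>
        \<not> l dvd q ^ card (cyc_coset q B \<delta>) - 1 \<longrightarrow>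
        full_reps l (q ^ card (cyc_coset q B \<delta>)) (S B l \<delta>))"

text \<open>\<open>gamma_seq q S p j N0 \<gamma> (m, a, t) k\<close> is \<open>\<gamma>_(I,k)\<close>, with \<open>\<gamma>_(I,0) = \<gamma>\<close> and \<open>B_1 = N_0\<close>.\<close>

primrec gamma_seq ::
    "nat \<Rightarrow> (nat \<Rightarrow> nat \<Rightarrow> int \<Rightarrow> nat set) \<Rightarrow> (nat \<Rightarrow> nat) \<Rightarrow> (nat \<Rightarrow> nat) \<Rightarrow> nat \<Rightarrow> int \<Rightarrow>
     (nat \<Rightarrow> enat) \<times> (nat \<Rightarrow> nat) \<times> (nat \<Rightarrow> nat) \<Rightarrow> nat \<Rightarrow> int" where
  "gamma_seq q S p j N0 \<gamma> I 0 = \<gamma>"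
| "gamma_seq q S p j N0 \<gamma> I (Suc k) =
     (let (m, a, t) = I; \<delta> = gamma_seq q S p j N0 \<gamma> I k; l = p (Suc k);
          B = (\<Prod>i = 1..k. p i ^ j i) * N0
      in case m (Suc k) of
           \<infinity> \<Rightarrow> \<delta> + int B * int (\<Sum>i\<le>j (Suc k) - 1. ladic_digit B l \<delta> i * l ^ i)
         | enat \<mu> \<Rightarrow>
             if p_exceptional q p (Suc k) (card (cyc_coset q N0 \<gamma>))
             then \<delta> + int B * int (U_int q S B 2 \<delta> \<mu> 1 + 2 ^ (\<mu> + 2) * t 1)
             else \<delta> + int B * int (U_int q S B l \<delta> \<mu> (a (Suc k)) + l ^ (\<mu> + 1) * t (Suc k)))"

end

theory Submission
  imports Defs
begin

text \<open>
  One prime \<open>l\<close> is added at a time. If \<open>\<delta>' \<equiv> \<delta>\<close> modulo \<open>B\<close>, \<open>l\<close> does not divide \<open>B\<close> and \<open>\<theta>\<close> is the size of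
  the coset of \<open>\<delta>\<close> modulo \<open>B\<close>, then the size of the coset of \<open>\<delta>'\<close> modulo \<open>B l^J\<close> is \<open>\<theta>\<close> times the order of
  \<open>q^\<theta>\<close> modulo \<open>l^(J - \<mu>)\<close>, where \<open>\<mu>\<close> is the minimum of \<open>J\<close> and the valuation of \<open>\<delta>'\<close> at \<open>l\<close>.
  The lifts in the construction either follow the \<open>l\<close>-adic digits of \<open>- \<delta> / B\<close> up to \<open>l^J\<close>, so that \<open>\<mu> = J\<close>,
  or leave them exactly at the digit of index \<open>\<mu>\<close>; the parameters \<open>t\<close> only affect higher digits.
  The orders modulo prime powers follow by lifting the exponent.
\<close>

section \<open>Sizes of cyclotomic cosets as multiplicative orders\<close>

text \<open>Dividing the congruence by gcd(M, \<gamma>) makes \<gamma> invertible for the remaining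
  modulus N = M / gcd(M, \<gamma>), so only the condition q^t = 1 modulo N is left.\<close>

lemma cong_power_iff_ord:
  fixes \<gamma> :: int
  assumes "M > 0"
  obtains N where "N dvd M"
    "\<And>t. [\<gamma> * int q ^ t = \<gamma>] (mod int M) \<longleftrightarrow> ord N q dvd t"
proof -
  define d where "d = gcd (int M) \<gamma>"
  have d: "d > 0" using assms by (simp add: d_def)
  obtain N' \<gamma>' where N': "int M = N' * d" and \<gamma>': "\<gamma> = \<gamma>' * d" and cop: "coprime N' \<gamma>'"
    using gcd_coprime_exists[of "int M" \<gamma>] d unfolding d_def by auto
  have "N' > 0"
    using N' d assms by (metis of_nat_0_less_iff zero_less_mult_pos2)
  then obtain N where N: "N' = int N" using pos_int_cases by blast
  show ?thesis
  proof
    show "N dvd M"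
      by (metis N N' dvd_triv_left int_dvd_int_iff)
    fix t
    have "[\<gamma> * int q ^ t = \<gamma>] (mod int M) \<longleftrightarrow> int M dvd \<gamma> * (int q ^ t - 1)"
      by (simp add: cong_iff_dvd_diff algebra_simps)
    also have "\<dots> \<longleftrightarrow> N' dvd \<gamma>' * (int q ^ t - 1)"
      using d by (simp add: N' \<gamma>' mult.assoc mult.commute[of _ d] mult.left_commute[of _ d])
    also have "\<dots> \<longleftrightarrow> N' dvd int q ^ t - 1"
      using cop by (simp add: coprime_dvd_mult_right_iff)
    also have "\<dots> \<longleftrightarrow> [int (q ^ t) = int 1] (mod int N)"
      by (simp add: N cong_iff_dvd_diff)
    also have "\<dots> \<longleftrightarrow> ord N q dvd t"
      by (simp only: cong_int_iff ord_divides)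
    finally show "[\<gamma> * int q ^ t = \<gamma>] (mod int M) \<longleftrightarrow> ord N q dvd t" .
  qed
qed

text \<open>The powers below the least period give distinct residues, so the size is that period.
  Describing it through its multiples allows later sizes to be compared by mutual divisibility,
  without handling \<open>LEAST\<close>.\<close>

lemma card_cyc_coset_dvd_iff:
  assumes "M > 0" "coprime M q"
  shows "card (cyc_coset q M \<gamma>) dvd t \<longleftrightarrow> [\<gamma> * int q ^ t = \<gamma>] (mod int M)"
proof -
  obtain N where N: "N dvd M" "\<And>t. [\<gamma> * int q ^ t = \<gamma>] (mod int M) \<longleftrightarrow> ord N q dvd t"
    using cong_power_iff_ord[OF assms(1), of \<gamma> q] by blast
  have "coprime N q" by (rule coprime_divisors[OF N(1) dvd_refl assms(2)])
  then have pos: "ord N q > 0" by simp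
  have least: "(LEAST t. t > 0 \<and> [\<gamma> * int q ^ t = \<gamma>] (mod int M)) = ord N q"
    unfolding N(2) using pos by (intro Least_equality) (auto intro: dvd_imp_le)
  \<comment> \<open>A repetition at exponents i < k would, after cancelling q^i, which is coprime to
    M, give the period k - i, smaller than \<open>ord N q\<close>.\<close>
  have neq: False if "i < k" "k < ord N q"
    "(\<gamma> * int q ^ i) mod int M = (\<gamma> * int q ^ k) mod int M" for i k
  proof -
    have "int M dvd \<gamma> * int q ^ k - \<gamma> * int q ^ i"
      using that(3)[symmetric] unfolding mod_eq_dvd_iff .
    also have "\<gamma> * int q ^ k - \<gamma> * int q ^ i = int q ^ i * (\<gamma> * int q ^ (k - i) - \<gamma>)"
      using that(1) by (simp add: algebra_simps flip: power_add)
    finally have "int M dvd \<gamma> * int q ^ (k - i) - \<gamma>"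
      using assms(2) by (simp add: coprime_dvd_mult_right_iff)
    then have "ord N q dvd k - i" unfolding N(2)[symmetric] cong_iff_dvd_diff .
    then show False using that(1,2) by (auto dest: dvd_imp_le)
  qed
  have "inj_on (\<lambda>i. (\<gamma> * int q ^ i) mod int M) {..<ord N q}"
  proof (rule linorder_inj_onI)
    fix i k
    assume "i < k" "i \<in> {..<ord N q}" "k \<in> {..<ord N q}"
    then show "(\<gamma> * int q ^ i) mod int M \<noteq> (\<gamma> * int q ^ k) mod int M"
      using neq[of i k] by blast
  qed auto
  then show ?thesis
    unfolding cyc_coset_def least unfolding N(2) by (simp add: card_image)
qed

lemma card_cyc_coset_pos:
  assumes "M > 0" "coprime M q"
  shows "card (cyc_coset q M \<gamma>) > 0"
proof -
  have "[q ^ ord M q = 1] (mod M)" by (rule ord)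
  then have "[int (q ^ ord M q) = int 1] (mod int M)" by (simp only: cong_int_iff)
  then have "[\<gamma> * int (q ^ ord M q) = \<gamma> * int 1] (mod int M)" by (rule cong_scalar_left)
  then have "card (cyc_coset q M \<gamma>) dvd ord M q"
    by (simp add: card_cyc_coset_dvd_iff[OF assms])
  moreover have "ord M q > 0" using assms(2) by simp
  ultimately show ?thesis by (rule dvd_pos_nat[rotated])
qed

text \<open>The congruence modulo B l^J splits into one modulo B and one modulo l^J. The hypothesis
  \<open>dvd\<close> says that l^J / gcd(l^J, \<delta>') = l^i without naming the valuation of
  \<delta>', which also covers \<delta>' = 0 with i = 0.\<close>

lemma card_cyc_coset_mult_prime_power:
  assumes B: "B > 0" "coprime B q" and l: "prime l" "\<not> l dvd B" "\<not> l dvd q"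
    and cong: "[\<delta>' = \<delta>] (mod int B)"
    and dvd: "\<And>z. int (l ^ J) dvd \<delta>' * z \<longleftrightarrow> int (l ^ i) dvd z"
  defines "\<theta> \<equiv> card (cyc_coset q B \<delta>)"
  shows "card (cyc_coset q (B * l ^ J) \<delta>') = \<theta> * ord (l ^ i) (q ^ \<theta>)"
proof -
  have copB: "coprime (l ^ J) B" and copq: "coprime (l ^ J) q"
    using l by (simp_all add: prime_imp_coprime)
  have pos: "B * l ^ J > 0" using B l(1) prime_gt_0_nat by simp
  have cop: "coprime (B * l ^ J) q" using B copq by simp
  have "card (cyc_coset q (B * l ^ J) \<delta>') dvd t \<longleftrightarrow> \<theta> * ord (l ^ i) (q ^ \<theta>) dvd t" for t
  proof -
    have "card (cyc_coset q (B * l ^ J) \<delta>') dvd t \<longleftrightarrow>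
        int B * int (l ^ J) dvd \<delta>' * int q ^ t - \<delta>'"
      by (simp add: card_cyc_coset_dvd_iff[OF pos cop] cong_iff_dvd_diff)
    also have "\<dots> \<longleftrightarrow> int B dvd \<delta>' * int q ^ t - \<delta>' \<and> int (l ^ J) dvd \<delta>' * int q ^ t - \<delta>'"
    proof
      assume "int B dvd \<delta>' * int q ^ t - \<delta>' \<and> int (l ^ J) dvd \<delta>' * int q ^ t - \<delta>'"
      moreover have "coprime (int B) (int (l ^ J))"
        unfolding coprime_int_iff using copB by (rule coprime_imp_coprime) auto
      ultimately show "int B * int (l ^ J) dvd \<delta>' * int q ^ t - \<delta>'"
        by (intro divides_mult) auto
    qed (auto dest: dvd_mult_left dvd_mult_right)
    also have "int B dvd \<delta>' * int q ^ t - \<delta>' \<longleftrightarrow> \<theta> dvd t"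
    proof -
      have "[\<delta>' * int q ^ t = \<delta> * int q ^ t] (mod int B)" using cong by (rule cong_scalar_right)
      then have "[\<delta>' * int q ^ t = \<delta>'] (mod int B) \<longleftrightarrow> [\<delta> * int q ^ t = \<delta>] (mod int B)"
        using cong by (auto intro: cong_trans dest: cong_sym)
      then show ?thesis
        by (simp add: \<theta>_def card_cyc_coset_dvd_iff[OF B] cong_iff_dvd_diff)
    qed
    also have "int (l ^ J) dvd \<delta>' * int q ^ t - \<delta>' \<longleftrightarrow> [q ^ t = 1] (mod l ^ i)"
    proof -
      have "\<delta>' * int q ^ t - \<delta>' = \<delta>' * (int (q ^ t) - int 1)" by (simp add: algebra_simps)
      then have "int (l ^ J) dvd \<delta>' * int q ^ t - \<delta>' \<longleftrightarrow> int (l ^ i) dvd int (q ^ t) - int 1"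
        by (simp only: dvd)
      also have "\<dots> \<longleftrightarrow> [int (q ^ t) = int 1] (mod int (l ^ i))"
        by (rule cong_iff_dvd_diff[symmetric])
      finally have "int (l ^ J) dvd \<delta>' * int q ^ t - \<delta>' \<longleftrightarrow> [int (q ^ t) = int 1] (mod int (l ^ i))" .
      then show ?thesis by (simp only: cong_int_iff)
    qed
    also have "\<theta> dvd t \<and> [q ^ t = 1] (mod l ^ i) \<longleftrightarrow> \<theta> * ord (l ^ i) (q ^ \<theta>) dvd t"
    \<comment> \<open>For t = \<theta> w the remaining condition is (q^\<theta>)^w = 1 modulo l^i,
      that is, a condition on w alone.\<close>
    proof (cases "\<theta> dvd t")
      case True
      then obtain w where w: "t = \<theta> * w" by blast
      have "\<theta> > 0" unfolding \<theta>_def using B by (rule card_cyc_coset_pos)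
      then show ?thesis by (simp add: w power_mult ord_divides')
    qed (auto dest: dvd_mult_left)
    finally show ?thesis .
  qed
  note iff = this
  show ?thesis by (rule dvd_antisym) (rule iff[THEN iffD2, OF dvd_refl] iff[THEN iffD1, OF dvd_refl])+
qed

section \<open>Subgroup indices in the unit group modulo a prime\<close>

lemma
  assumes "prime l"
  shows group_unit_group: "Group.group (unit_group l)"
    and carrier_unit_group: "carrier (unit_group l) = {1..int l - 1}"
    and order_unit_group: "order (unit_group l) = l - 1"
proof -
  interpret residues_prime l "residue_ring (int l)"
    by unfold_locales (use assms in auto)
  show "Group.group (unit_group l)" unfolding unit_group_def by (rule units_group)
  show carrier: "carrier (unit_group l) = {1..int l - 1}"
    unfolding unit_group_def using prime_ge_1_nat[OF assms]
    by (simp add: units_of_carrier res_prime_units_eq)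
  show "order (unit_group l) = l - 1"
    using prime_ge_1_nat[OF assms] by (simp add: order_def carrier nat_diff_distrib)
qed

lemma
  assumes "prime l" "\<not> l dvd x"
  shows mod_in_unit_group: "int x mod int l \<in> carrier (unit_group l)"
    and subgroup_cyc_subgroup: "subgroup (cyc_subgroup l x) (unit_group l)"
proof -
  have "l > 0" using assms(1) prime_gt_0_nat by blast
  have "x mod l \<noteq> 0" using assms(2) by (simp add: mod_eq_0_iff_dvd)
  moreover have "x mod l < l" using \<open>l > 0\<close> by simp
  ultimately show *: "int x mod int l \<in> carrier (unit_group l)"
    by (simp add: carrier_unit_group[OF assms(1)] flip: zmod_int)
  then show "subgroup (cyc_subgroup l x) (unit_group l)"
    unfolding cyc_subgroup_def
    by (intro group.generate_is_subgroup group_unit_group assms(1)) simp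
qed

text \<open>This is Lagrange's theorem, once the order of the class of x in the group is identified
  with the number-theoretic \<open>ord l x\<close>.\<close>

lemma unit_index_mult_ord:
  assumes "prime l" "\<not> l dvd x"
  shows "unit_index l x * ord l x = l - 1"
proof -
  interpret residues_prime l "residue_ring (int l)"
    by unfold_locales (use assms in auto)
  interpret G: group "unit_group l" using assms(1) by (rule group_unit_group)
  let ?a = "int x mod int l"
  note a = mod_in_unit_group[OF assms] subgroup_cyc_subgroup[OF assms]
  have pw: "?a [^]\<^bsub>unit_group l\<^esub> k = int (x ^ k) mod int l" for k :: nat
  proof -
    have "?a \<in> Units (residue_ring (int l))"
      using a(1) by (simp add: unit_group_def units_of_carrier)
    then show ?thesis
      unfolding unit_group_def by (simp add: units_of_pow pow_cong)
  qed
  have one: "\<one>\<^bsub>unit_group l\<^esub> = int 1 mod int l"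
    unfolding unit_group_def units_of_one using one_cong by simp
  have "group.ord (unit_group l) ?a dvd k \<longleftrightarrow> ord l x dvd k" for k
  proof -
    have "group.ord (unit_group l) ?a dvd k \<longleftrightarrow> ?a [^]\<^bsub>unit_group l\<^esub> k = \<one>\<^bsub>unit_group l\<^esub>"
      using a(1) by (simp add: G.pow_eq_id)
    also have "\<dots> \<longleftrightarrow> [int (x ^ k) = int 1] (mod int l)"
      unfolding pw one cong_def ..
    also have "\<dots> \<longleftrightarrow> ord l x dvd k" by (simp only: cong_int_iff ord_divides)
    finally show ?thesis .
  qed
  then have "group.ord (unit_group l) ?a = ord l x" by (meson dvd_antisym dvd_refl)
  then have "card (cyc_subgroup l x) = ord l x"
    using G.generate_pow_card[OF a(1)] by (simp add: cyc_subgroup_def)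
  then show ?thesis
    using G.lagrange[OF a(2)] by (simp add: unit_index_def order_unit_group[OF assms(1)])
qed

lemma ord_eq_div_unit_index:
  assumes "prime l" "\<not> l dvd x"
  shows "ord l x = (l - 1) div unit_index l x"
  using unit_index_mult_ord[OF assms] prime_gt_1_nat[OF assms(1)]
  by (metis mult_is_0 nonzero_mult_div_cancel_left zero_less_diff less_numeral_extra(3))

text \<open>Distinct cosets are disjoint, so choosing a representative in each is injective. The
  bound ensures that the list lookup in \<open>U_int\<close> stays in range.\<close>

lemma unit_index_le_card_full_reps:
  assumes "prime l" "\<not> l dvd x" "full_reps l x S"
  shows "unit_index l x \<le> card S"
proof -
  interpret G: group "unit_group l" using assms(1) by (rule group_unit_group)
  let ?R = "rcosets\<^bsub>unit_group l\<^esub> (cyc_subgroup l x)"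
  note H = subgroup_cyc_subgroup[OF assms(1,2)]
  have "finite S" using assms(3) finite_subset unfolding full_reps_def by blast
  obtain \<sigma> where \<sigma>: "\<And>C. C \<in> ?R \<Longrightarrow> \<sigma> C \<in> S \<and> int (\<sigma> C) \<in> C"
    using assms(3) unfolding full_reps_def by metis
  have "inj_on \<sigma> ?R"
    using \<sigma> G.rcos_disjoint[OF H] unfolding inj_on_def pairwise_def disjnt_def
    by (metis IntI empty_iff)
  then show ?thesis
    unfolding unit_index_def using \<sigma> \<open>finite S\<close> by (intro card_inj_on_le[of \<sigma>]) auto
qed

section \<open>Lifting the exponent and orders modulo prime powers\<close>

text \<open>The sum is congruent to l modulo l^2, hence has exactly one factor l. This is the factor
  gained when passing from Q - 1 to Q^l - 1.\<close>

lemma geometric_sum_prime_valuation: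
  fixes R :: int
  assumes l: "prime l" and R: "[R = 1] (mod int l)" and two: "l = 2 \<Longrightarrow> [R = 1] (mod 4)"
  obtains w where "(\<Sum>k<l. R ^ k) = int l * w" "\<not> int l dvd w"
proof -
  have l2: "l \<ge> 2" using l by (rule prime_ge_2_nat)
  obtain c where c: "R = 1 + int l * c"
    using R by (metis cong_iff_lin cong_sym)
  \<comment> \<open>Binomial expansion of (1 + l c)^k, cut off after the linear term.\<close>
  have pow: "[R ^ k = 1 + int k * (int l * c)] (mod int l ^ 2)" for k
  proof (induction k)
    case (Suc k)
    have "[R ^ Suc k = (1 + int l * c) * (1 + int k * (int l * c))] (mod int l ^ 2)"
      using cong_mult[OF cong_refl Suc, of R] by (simp add: c)
    also have "(1 + int l * c) * (1 + int k * (int l * c)) =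
      1 + int (Suc k) * (int l * c) + int l ^ 2 * (int k * c ^ 2)"
      by (simp add: algebra_simps power2_eq_square)
    also have "[\<dots> = 1 + int (Suc k) * (int l * c)] (mod int l ^ 2)"
      by (simp add: cong_iff_dvd_diff)
    finally show ?case .
  qed simp
  have "[(\<Sum>k<l. R ^ k) = int l] (mod int l ^ 2)"
  proof (cases "l = 2")
    case True
    have "[1 + R = 1 + 1] (mod 4)" using two[OF True] by (intro cong_add) auto
    then show ?thesis by (simp add: True eval_nat_numeral)
  next
    case False
    then have "odd l" using l by (metis prime_odd_nat l2 le_neq_implies_less)
    then obtain r where r: "l = 2 * r + 1" by (rule oddE)
    \<comment> \<open>For odd l the exponents sum to a multiple of l, so the linear terms add up to
      a multiple of l^2. This fails for l = 2, whence the hypothesis modulo 4.\<close>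
    have gauss: "(\<Sum>k<l. int k) = int l * int r"
    proof -
      have "2 * (\<Sum>k<n. int k) = int n * (int n - 1)" for n
        by (induction n) (simp_all add: algebra_simps)
      from this[of l] show ?thesis by (simp add: r)
    qed
    have "[(\<Sum>k<l. R ^ k) = (\<Sum>k<l. 1 + int k * (int l * c))] (mod int l ^ 2)"
      by (intro cong_sum pow)
    also have "(\<Sum>k<l. 1 + int k * (int l * c)) = int l + (\<Sum>k<l. int k) * (int l * c)"
      by (simp add: sum.distrib sum_distrib_right)
    also have "\<dots> = int l + int l ^ 2 * (int r * c)"
      unfolding gauss by (simp add: power2_eq_square algebra_simps)
    also have "[\<dots> = int l] (mod int l ^ 2)" by (simp add: cong_iff_dvd_diff)
    finally show ?thesis .
  qed
  then obtain z where z: "(\<Sum>k<l. R ^ k) = int l + int l ^ 2 * z"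
    by (metis cong_iff_lin cong_sym)
  show ?thesis
  proof
    show "(\<Sum>k<l. R ^ k) = int l * (1 + int l * z)"
      by (simp add: z algebra_simps power2_eq_square)
    show "\<not> int l dvd 1 + int l * z"
      using l2 by (simp add: dvd_add_left_iff)
  qed
qed

lemma lifting_the_exponent:
  assumes l: "prime l" and R: "int l ^ v dvd R - 1" "\<not> int l ^ Suc v dvd R - 1" "v > 0"
    and two: "l = 2 \<Longrightarrow> v \<ge> 2"
  shows "int l ^ (v + a) dvd R ^ (l ^ a) - 1 \<and> \<not> int l ^ Suc (v + a) dvd R ^ (l ^ a) - 1"
proof (induction a)
  case (Suc a)
  \<comment> \<open>The induction step factors Q^l - 1 as Q - 1 times the geometric sum, which
    contributes exactly one more l.\<close>
  define Q where "Q = R ^ (l ^ a)"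
  have l0: "int l > 0" using l prime_gt_0_nat by simp
  obtain b where b: "Q - 1 = int l ^ (v + a) * b" using Suc Q_def by blast
  then have nb: "\<not> int l dvd b" using Suc l0 by (auto simp: Q_def)
  have "int l dvd int l ^ (v + a)" using R(3) by (simp add: dvd_power)
  then have "[Q = 1] (mod int l)" by (simp add: cong_iff_dvd_diff b)
  moreover have "[Q = 1] (mod 4)" if "l = 2"
  proof -
    have "(2::int) ^ 2 dvd 2 ^ (v + a)" using two[OF that] by (intro le_imp_power_dvd) simp
    then show ?thesis by (simp add: cong_iff_dvd_diff b that)
  qed
  ultimately obtain w where w: "(\<Sum>k<l. Q ^ k) = int l * w" "\<not> int l dvd w"
    using geometric_sum_prime_valuation[OF l] by blast
  have "R ^ (l ^ Suc a) - 1 = Q ^ l - 1"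
    by (simp add: Q_def power_mult mult.commute[of l] flip: power_mult)
  also have "\<dots> = (Q - 1) * (\<Sum>k<l. Q ^ k)" by (rule power_diff_1_eq)
  also have "\<dots> = int l ^ (v + Suc a) * (b * w)" by (simp add: b w(1))
  finally have eq: "R ^ (l ^ Suc a) - 1 = int l ^ (v + Suc a) * (b * w)" .
  have "\<not> int l dvd b * w"
    using nb w(2) l by (simp add: prime_dvd_mult_iff)
  then show ?case unfolding eq using l0 by simp
qed (use R in simp)

lemma ord_prime_power_of_valuation:
  assumes l: "prime l" and R1: "R > 1" and v: "v = multiplicity l (R - 1)"
    and vpos: "v > 0" and two: "l = 2 \<Longrightarrow> v \<ge> 2"
  shows "ord (l ^ i) R = l ^ (i - v)"
proof -
  have nz: "R - 1 \<noteq> 0" "\<not> is_unit l" using R1 l by auto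
  have iff: "[R ^ t = 1] (mod l ^ k) \<longleftrightarrow> int l ^ k dvd int R ^ t - 1" for t k
  proof -
    have "[R ^ t = 1] (mod l ^ k) \<longleftrightarrow> [int (R ^ t) = int 1] (mod int (l ^ k))"
      by (simp only: cong_int_iff)
    then show ?thesis by (simp add: cong_iff_dvd_diff)
  qed
  have "int (l ^ k) dvd int (R - 1) \<longleftrightarrow> k \<le> v" for k
    unfolding int_dvd_int_iff v using nz by (simp add: power_dvd_iff_le_multiplicity)
  then have R': "int l ^ v dvd int R - 1" "\<not> int l ^ Suc v dvd int R - 1"
    using R1 by (auto simp: of_nat_diff simp del: power_Suc)
  note lte = lifting_the_exponent[OF l R' vpos two]
  have dvd: "ord (l ^ i) R dvd l ^ (i - v)"
  proof -
    have "int l ^ i dvd int l ^ (v + (i - v))" by (intro le_imp_power_dvd) simp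
    then have "int l ^ i dvd int R ^ (l ^ (i - v)) - 1" using lte dvd_trans by blast
    then show ?thesis by (simp flip: iff ord_divides)
  qed
  then obtain b where b: "b \<le> i - v" "ord (l ^ i) R = l ^ b"
    using l divides_primepow_nat by blast
  \<comment> \<open>The order is a power l^b. By the exact valuation v + b of R^(l^b) - 1, a smaller
    b would not reach l^i.\<close>
  have "b \<ge> i - v"
  proof (rule ccontr)
    assume "\<not> ?thesis"
    then have "Suc (v + b) \<le> i" by simp
    then have "int l ^ Suc (v + b) dvd int l ^ i" by (rule le_imp_power_dvd)
    moreover have "int l ^ i dvd int R ^ (l ^ b) - 1"
      using ord[of R "l ^ i"] unfolding b(2) iff .
    ultimately show False using lte dvd_trans by blast
  qed
  with b show ?thesis by simp
qed

text \<open>The order modulo l divides the order modulo l^i, so the latter is \<open>ord l Q\<close>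
  times the order of R = Q^(ord l Q). As R is 1 modulo l, the previous lemma applies to R.\<close>

lemma ord_prime_power:
  assumes l: "prime l" and Q: "Q > 1" "\<not> l dvd Q" and two: "l = 2 \<Longrightarrow> [Q = 1] (mod 4)"
    and i: "i > 0"
  defines "v \<equiv> multiplicity l (Q ^ ord l Q - 1)"
  shows "ord (l ^ i) Q = l ^ (i - v) * ord l Q"
proof -
  define R where "R = Q ^ ord l Q"
  have cop: "coprime l Q" using l Q(2) prime_imp_coprime by blast
  have "ord l Q > 0" using cop by simp
  then have R1: "R > 1" using Q(1) unfolding R_def by (rule one_less_power[rotated])
  have nz: "R - 1 \<noteq> 0" "\<not> is_unit l" using R1 l by auto
  have "[R = 1] (mod l)" unfolding R_def by (rule ord)
  then have "l ^ 1 dvd R - 1" using R1 by (simp add: cong_altdef_nat)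
  then have vpos: "v > 0"
    using power_dvd_iff_le_multiplicity[of "R - 1" l 1] nz by (simp add: v_def R_def)
  have v2: "v \<ge> 2" if "l = 2"
  proof -
    have "[R = 1 ^ ord l Q] (mod 4)" unfolding R_def using two[OF that] by (rule cong_pow)
    then have "l ^ 2 dvd R - 1" using R1 that by (simp add: cong_altdef_nat)
    then show ?thesis
      using power_dvd_iff_le_multiplicity[of "R - 1" l 2] nz by (simp add: v_def R_def)
  qed
  have "ord (l ^ i) R = l ^ (i - v)"
    by (rule ord_prime_power_of_valuation[OF l R1 _ vpos v2]) (simp add: v_def R_def)
  moreover have "ord (l ^ i) Q = ord (l ^ i) R * ord l Q"
  proof -
    have "l dvd l ^ i" using i by (simp add: dvd_power)
    then have "ord l Q dvd ord (l ^ i) Q"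
      by (metis cong_dvd_modulus_nat ord ord_divides)
    then have "gcd (ord l Q) (ord (l ^ i) Q) = ord l Q" by (simp add: gcd_proj1_iff)
    then show ?thesis using ord_power_aux[of "l ^ i" Q "ord l Q"] by (simp add: R_def)
  qed
  ultimately show ?thesis by simp
qed

text \<open>Here Q - 1 has 2-adic valuation 1, too small for lifting the exponent. The square works:
  Q^2 - 1 = (Q + 1)(Q - 1) has valuation v + 1, and passing to Q^2 halves the order.\<close>

lemma ord_two_power_3_mod_4:
  fixes Q :: nat
  assumes Q: "[Q = 3] (mod 4)" and i: "i \<ge> 2"
  shows "ord (2 ^ i) Q = 2 ^ max 1 (i - multiplicity 2 (Q + 1))"
proof -
  define v where "v = multiplicity 2 (Q + 1)"
  have Q3: "Q mod 4 = 3" using Q by (simp add: cong_def)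
  then obtain c where c: "Q = 4 * c + 3" by (metis mod_eqE mult.commute div_mult_mod_eq)
  have Q1: "Q > 1" by (simp add: c)
  then have Qsq: "Q ^ 2 > 1" by (rule one_less_power) simp
  have "multiplicity 2 (Q ^ 2 - 1) = multiplicity 2 ((Q + 1) * (Q - 1))"
    by (simp add: power2_eq_square algebra_simps)
  also have "\<dots> = v + multiplicity 2 (Q - 1)"
    unfolding v_def using Q1 by (intro prime_elem_multiplicity_mult_distrib) auto
  also have "multiplicity 2 (Q - 1) = 1"
  proof -
    have "Q - 1 = 2 ^ 1 * (2 * c + 1)" by (simp add: c)
    then show ?thesis by (rule multiplicity_decomposeI) auto
  qed
  finally have v: "Suc v = multiplicity 2 (Q ^ 2 - 1)" by simp
  have "2 ^ 2 dvd Q + 1" by (simp add: c)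
  then have v2: "v \<ge> 2" unfolding v_def by (intro multiplicity_geI) auto
  have "ord (2 ^ i) (Q ^ 2) = 2 ^ (i - Suc v)"
    by (rule ord_prime_power_of_valuation[OF _ Qsq v])
      (use v2 in auto)
  moreover have "ord (2 ^ i) Q = ord (2 ^ i) (Q ^ 2) * 2"
  proof -
    \<comment> \<open>Since 4 divides 2^i, the order 2 modulo 4 forces the order modulo 2^i to be
      even.\<close>
    have "ord 4 Q = ord 4 (3 :: nat)" using Q by (rule ord_cong)
    then have "ord 4 Q = 2" by simp
    moreover have "(2::nat) ^ 2 dvd 2 ^ i" using i by (rule le_imp_power_dvd)
    ultimately have "2 dvd ord (2 ^ i) Q"
      by (metis cong_dvd_modulus_nat ord ord_divides power2_eq_square numeral_Bit0 mult_2)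
    then have "gcd 2 (ord (2 ^ i) Q) = 2" by (simp add: gcd_proj1_iff)
    then show ?thesis using ord_power_aux[of "2 ^ i" Q 2] by simp
  qed
  ultimately have "ord (2 ^ i) Q = 2 ^ Suc (i - Suc v)" by simp
  also have "Suc (i - Suc v) = max 1 (i - v)" by auto
  finally show ?thesis unfolding v_def .
qed

section \<open>Following and leaving the l-adic digits\<close>

lemma ladic_digit_expansion:
  assumes "prime l" "\<not> l dvd B"
  shows "ladic_digit B l \<delta> k < l"
    "int l ^ n dvd \<delta> + int B * int (\<Sum>k<n. ladic_digit B l \<delta> k * l ^ k)"
proof -
  have E: "is_ladic_expansion B l \<delta> (ladic_digit B l \<delta>)"
    unfolding ladic_digit_def by (rule theI'[OF ex1_ladic_expansion[OF assms]])
  have "ladic_digit B l \<delta> k \<le> l - 1" using E by (simp add: is_ladic_expansion_def)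
  then show "ladic_digit B l \<delta> k < l" using prime_gt_0_nat[OF assms(1)] by linarith
  have "[int B * int (\<Sum>k<n. ladic_digit B l \<delta> k * l ^ k) = - \<delta>] (mod int l ^ n)"
    using E unfolding is_ladic_expansion_def by blast
  then show "int l ^ n dvd \<delta> + int B * int (\<Sum>k<n. ladic_digit B l \<delta> k * l ^ k)"
    by (simp only: cong_iff_dvd_diff diff_minus_eq_add add.commute)
qed

text \<open>With the true digits up to index \<mu> the value is divisible by l^(\<mu>+1). Replacing
  the last of them by u changes it by B (u - \<phi>_\<mu>) l^\<mu>, whose valuation is exactly
  \<mu>, and the term in w lies in higher order.\<close>

lemma valuation_of_wrong_digit:
  assumes l: "prime l" "\<not> l dvd B" and u: "u < l" "u \<noteq> ladic_digit B l \<delta> \<mu>"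
  obtains c where "\<not> int l dvd c"
    "\<delta> + int B * int ((\<Sum>k<\<mu>. ladic_digit B l \<delta> k * l ^ k) + u * l ^ \<mu> + l ^ (\<mu> + 1) * w)
      = int l ^ \<mu> * c"
proof -
  define \<phi> where "\<phi> = ladic_digit B l \<delta>"
  have "int l ^ Suc \<mu> dvd \<delta> + int B * int (\<Sum>k<Suc \<mu>. \<phi> k * l ^ k)"
    unfolding \<phi>_def using l by (rule ladic_digit_expansion(2))
  then obtain d where d: "\<delta> + int B * int (\<Sum>k<Suc \<mu>. \<phi> k * l ^ k) = int l ^ Suc \<mu> * d"
    by blast
  let ?e = "int B * (int u - int (\<phi> \<mu>))"
  have "\<not> int l dvd ?e + int l * (d + int B * int w)"
  proof
    assume "int l dvd ?e + int l * (d + int B * int w)"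
    then have "int l dvd ?e" by (simp add: dvd_add_left_iff)
    then have "int l dvd int u - int (\<phi> \<mu>)" using l by (simp add: prime_dvd_mult_iff)
    then have "[u = \<phi> \<mu>] (mod l)" by (simp add: cong_int_iff flip: cong_iff_dvd_diff)
    then have "u = \<phi> \<mu>"
      using u(1) ladic_digit_expansion(1)[OF l] unfolding \<phi>_def
      by (rule cong_less_modulus_unique_nat)
    then show False using u(2) by (simp add: \<phi>_def)
  qed
  moreover have "\<delta> + int B * int ((\<Sum>k<\<mu>. \<phi> k * l ^ k) + u * l ^ \<mu> + l ^ (\<mu> + 1) * w) =
      (\<delta> + int B * int (\<Sum>k<Suc \<mu>. \<phi> k * l ^ k)) + int l ^ \<mu> * (?e + int l * (int B * int w))"
    by (simp add: algebra_simps)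
  then have "\<delta> + int B * int ((\<Sum>k<\<mu>. \<phi> k * l ^ k) + u * l ^ \<mu> + l ^ (\<mu> + 1) * w) =
      int l ^ \<mu> * (?e + int l * (d + int B * int w))"
    unfolding d by (simp add: algebra_simps)
  ultimately show ?thesis using that unfolding \<phi>_def by blast
qed

text \<open>Both cases of the definition of U produce a digit different from \<phi>_m; nothing else
  about U matters for the coset size.\<close>

lemma U_int_eq:
  assumes B: "B > 0" "coprime B q" and l: "prime l" "\<not> l dvd B" "\<not> l dvd q" "l \<noteq> p"
    and S: "reps_choice p q S"
    and a: "a \<in> {1..unit_index l (q ^ card (cyc_coset q B \<delta>))}"
  obtains u where "u < l" "u \<noteq> ladic_digit B l \<delta> m"
    "U_int q S B l \<delta> m a = (\<Sum>k<m. ladic_digit B l \<delta> k * l ^ k) + u * l ^ m"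
proof -
  define \<theta> where "\<theta> = card (cyc_coset q B \<delta>)"
  define \<phi> where "\<phi> = ladic_digit B l \<delta>"
  define u where "u = (if l dvd q ^ \<theta> - 1 then sorted_list_of_set ({0..l - 1} - {\<phi> m}) ! (a - 1)
               else (\<phi> m + sorted_list_of_set (S B l \<delta>) ! (a - 1)) mod l)"
  have nd: "\<not> l dvd q ^ \<theta>" using l prime_dvd_power by blast
  have \<phi>: "\<phi> m < l" unfolding \<phi>_def using l(1,2) by (rule ladic_digit_expansion(1))
  have "u < l \<and> u \<noteq> \<phi> m"
  proof (cases "l dvd q ^ \<theta> - 1")
    case True
    \<comment> \<open>This bounds a by l - 1, the number of digits other than \<phi>_m, so the
      lookup at a - 1 is in range.\<close>
    have "unit_index l (q ^ \<theta>) dvd l - 1"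
      using unit_index_mult_ord[OF l(1) nd] by (metis dvd_triv_left)
    then have "a \<le> l - 1"
      using a prime_gt_1_nat[OF l(1)] dvd_imp_le[of _ "l - 1"] by (fastforce simp: \<theta>_def)
    moreover have "card ({0..l - 1} - {\<phi> m}) = l - 1"
      using \<phi> by (simp add: card_Diff_singleton_if)
    ultimately have "a - 1 < length (sorted_list_of_set ({0..l - 1} - {\<phi> m}))"
      using a by auto
    then have "u \<in> set (sorted_list_of_set ({0..l - 1} - {\<phi> m}))"
      using True unfolding u_def by (metis nth_mem)
    then show ?thesis using \<phi> by auto
  next
    case False
    let ?T = "S B l \<delta>"
    let ?\<sigma> = "sorted_list_of_set ?T ! (a - 1)"
    have full: "full_reps l (q ^ \<theta>) ?T"
      using S B l False unfolding reps_choice_def \<theta>_def by blast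
    have T: "finite ?T" "?T \<subseteq> {1..l - 1}"
      using full unfolding full_reps_def by (auto intro: finite_subset)
    have "unit_index l (q ^ \<theta>) \<le> card ?T"
      using l(1) nd full by (rule unit_index_le_card_full_reps)
    then have "a - 1 < length (sorted_list_of_set ?T)"
      using a by (auto simp: \<theta>_def)
    then have "?\<sigma> \<in> ?T" using T(1) by (metis nth_mem set_sorted_list_of_set)
    then have "?\<sigma> \<in> {1..l - 1}" using T(2) by blast
    then have \<sigma>: "?\<sigma> > 0" "?\<sigma> < l" using prime_gt_0_nat[OF l(1)] by auto
    \<comment> \<open>A representative lies strictly between 0 and l, so adding it moves the digit
      modulo l.\<close>
    have "(\<phi> m + ?\<sigma>) mod l \<noteq> \<phi> m"
    proof
      assume "(\<phi> m + ?\<sigma>) mod l = \<phi> m"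
      then have "[\<phi> m + ?\<sigma> = \<phi> m] (mod l)" using \<phi> by (simp add: cong_def)
      then have "l dvd ?\<sigma>" by (simp add: cong_add_lcancel_0_nat cong_0_iff)
      then show False using \<sigma> dvd_imp_le by force
    qed
    then show ?thesis using False \<phi> by (simp add: u_def)
  qed
  then show ?thesis
    by (intro that[of u]) (simp_all add: U_int_def Let_def u_def \<phi>_def \<theta>_def)
qed

lemma card_cyc_coset_wrong_digit:
  assumes B: "B > 0" "coprime B q" and l: "prime l" "\<not> l dvd B" "\<not> l dvd q" "l \<noteq> p"
    and S: "reps_choice p q S" and \<mu>: "\<mu> \<le> J"
    and a: "a \<in> {1..unit_index l (q ^ card (cyc_coset q B \<delta>))}"
  defines "\<theta> \<equiv> card (cyc_coset q B \<delta>)"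
  shows "card (cyc_coset q (B * l ^ J) (\<delta> + int B * int (U_int q S B l \<delta> \<mu> a + l ^ (\<mu> + 1) * w)))
    = \<theta> * ord (l ^ (J - \<mu>)) (q ^ \<theta>)"
  unfolding \<theta>_def
proof (rule card_cyc_coset_mult_prime_power[OF B l(1-3)])
  let ?\<delta>' = "\<delta> + int B * int (U_int q S B l \<delta> \<mu> a + l ^ (\<mu> + 1) * w)"
  show "[?\<delta>' = \<delta>] (mod int B)" by (simp add: cong_iff_dvd_diff)
  obtain u where u: "u < l" "u \<noteq> ladic_digit B l \<delta> \<mu>"
    "U_int q S B l \<delta> \<mu> a = (\<Sum>k<\<mu>. ladic_digit B l \<delta> k * l ^ k) + u * l ^ \<mu>"
    using U_int_eq[OF B l S a] .
  obtain c where c: "\<not> int l dvd c" "?\<delta>' = int l ^ \<mu> * c"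
    unfolding u(3) using valuation_of_wrong_digit[OF l(1,2) u(1,2)] .
  fix z
  have l0: "int l > 0" using l(1) prime_gt_0_nat by simp
  have "coprime (int (l ^ (J - \<mu>))) c"
    using l(1) c(1) by (simp add: prime_imp_coprime)
  moreover have "int (l ^ J) = int l ^ \<mu> * int (l ^ (J - \<mu>))"
    using \<mu> by (simp flip: power_add)
  ultimately show "int (l ^ J) dvd ?\<delta>' * z \<longleftrightarrow> int (l ^ (J - \<mu>)) dvd z"
    unfolding c(2) using l0
    by (simp only: mult.assoc) (simp add: coprime_dvd_mult_right_iff)
qed

section \<open>The general construction, one prime at a time\<close>

theorem card_cyc_coset_gamma_seq:
  assumes p: "prime p" "q = p ^ h" "h > 0" and N0: "N0 > 0" "coprime N0 q"
    and ps: "\<And>k. k \<in> {1..s} \<Longrightarrow> prime (ps k) \<and> ps k \<noteq> p \<and> \<not> ps k dvd N0 \<and> j k > 0"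
    and mono: "strict_mono_on {1..s} ps" and S: "reps_choice p q S"
    and \<tau>: "\<tau> = card (cyc_coset q N0 \<gamma>)"
    and I: "(m, a, t) \<in> index_set q s ps j \<tau>"
    and "k \<le> s"
  shows "card (cyc_coset q ((\<Prod>i = 1..k. ps i ^ j i) * N0)
      (gamma_seq q S ps j N0 \<gamma> (m, a, t) k)) = tau_seq q ps j \<tau> m k"
  using \<open>k \<le> s\<close>
proof (induction k)
  case 0
  then show ?case by (simp add: \<tau>)
next
  case (Suc k)
  define l B \<delta> \<theta> J where "l = ps (Suc k)" and "B = (\<Prod>i = 1..k. ps i ^ j i) * N0"
    and "\<delta> = gamma_seq q S ps j N0 \<gamma> (m, a, t) k" and "\<theta> = tau_seq q ps j \<tau> m k"
    and "J = j (Suc k)"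
  define \<delta>' where "\<delta>' = gamma_seq q S ps j N0 \<gamma> (m, a, t) (Suc k)"
  have \<theta>: "card (cyc_coset q B \<delta>) = \<theta>"
    unfolding B_def \<delta>_def \<theta>_def using Suc by simp
  have k: "Suc k \<in> {1..s}" using Suc.prems by simp
  have l: "prime l" "l \<noteq> p" and J: "J > 0"
    unfolding l_def J_def using ps[OF k] by blast+
  have not_dvd_q: "\<not> ps i dvd q" if "i \<in> {1..s}" for i
    using ps[OF that] p primes_dvd_imp_eq prime_dvd_power by metis
  then have lq: "\<not> l dvd q" unfolding l_def using k by blast
  have cop: "coprime (ps i ^ j i) q" if "i \<in> {1..s}" for i
    using not_dvd_q[OF that] ps[OF that] by (simp add: prime_imp_coprime)
  have B: "B > 0" "coprime B q"
    unfolding B_def using Suc.prems N0 ps cop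
    by (auto intro!: prod_pos prod_coprime_left simp: prime_gt_0_nat)
  have lB: "\<not> l dvd B"
  proof
    assume "l dvd B"
    then have "l dvd (\<Prod>i = 1..k. ps i ^ j i)"
      using ps[OF k] l(1) unfolding B_def l_def by (simp add: prime_dvd_mult_iff)
    then obtain i where i: "i \<in> {1..k}" "l dvd ps i ^ j i"
      using l(1) by (auto simp: prime_dvd_prod_iff)
    then have i_le: "i \<in> {1..s}" using Suc.prems by simp
    have "l = ps i"
      using i(2) l(1) ps[OF i_le] primes_dvd_imp_eq prime_dvd_power by metis
    moreover have "ps i < ps (Suc k)"
      using mono i_le k i(1) by (intro strict_mono_onD[OF mono]) auto
    ultimately show False by (simp add: l_def)
  qed
  have \<theta>0: "\<theta> > 0" using card_cyc_coset_pos[OF B] \<theta> by metis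
  have "q > 1" unfolding p(2) using prime_gt_1_nat[OF p(1)] p(3) by (rule one_less_power)
  then have Q1: "q ^ \<theta> > 1" using \<theta>0 by (rule one_less_power)
  have lQ: "\<not> l dvd q ^ \<theta>" using l lq prime_dvd_power by blast
  note index = unit_index_mult_ord[OF l(1) lQ]
  \<comment> \<open>\<open>gamma_seq\<close> tests the exceptional case with the coset size modulo
    N0, \<open>tau_seq\<close> with the current size. The case occurs only at the first prime, where
    both sizes are \<tau>.\<close>
  have exc: "p_exceptional q ps (Suc k) (card (cyc_coset q N0 \<gamma>)) = p_exceptional q ps (Suc k) \<theta>"
    unfolding p_exceptional_def by (cases k) (auto simp: \<theta>_def \<tau>)
  have "card (cyc_coset q (B * l ^ J) \<delta>') = tau_seq q ps j \<tau> m (Suc k)"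
  proof (cases "m (Suc k)")
    case infinity
    \<comment> \<open>All J digits are followed, so l^J divides \<delta>' and the order is taken
      modulo l^0 = 1: the size does not grow.\<close>
    have "card (cyc_coset q (B * l ^ J) \<delta>') =
        card (cyc_coset q B \<delta>) * ord (l ^ 0) (q ^ card (cyc_coset q B \<delta>))"
    proof (rule card_cyc_coset_mult_prime_power[OF B l(1) lB lq])
      have "{..J - 1} = {..<J}" using J by auto
      then have \<delta>': "\<delta>' = \<delta> + int B * int (\<Sum>i<J. ladic_digit B l \<delta> i * l ^ i)"
        using infinity by (simp add: \<delta>'_def \<delta>_def B_def l_def J_def Let_def)
      then show "[\<delta>' = \<delta>] (mod int B)" by (simp add: cong_iff_dvd_diff)
      show "int (l ^ J) dvd \<delta>' * z \<longleftrightarrow> int (l ^ 0) dvd z" for z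
        using ladic_digit_expansion(2)[OF l(1) lB, of J \<delta>] by (simp add: \<delta>')
    qed
    then show ?thesis using infinity by (simp add: \<theta> Let_def) (simp add: \<theta>_def)
  next
    case (enat \<mu>)
    have "m (Suc k) \<in> insert \<infinity> (enat ` {0..J - 1})"
      using I k unfolding index_set_def J_def by blast
    then have \<mu>: "\<mu> < J" using enat J by auto
    have a_range: "a (Suc k) \<in> {1..unit_index l (q ^ \<theta>)}" if "\<not> p_exceptional q ps (Suc k) \<theta>"
      using I k enat that unfolding index_set_def \<theta>_def l_def Let_def by force
    show ?thesis
    proof (cases "p_exceptional q ps (Suc k) \<theta>")
      case True
      then have k0: "k = 0" and l2: "l = 2" and Q3: "[q ^ \<theta> = 3] (mod 4)"
        by (auto simp: p_exceptional_def l_def)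
      have "p_exceptional q ps (Suc k) (card (cyc_coset q N0 \<gamma>))" using True exc by simp
      \<comment> \<open>Writing 2^(\<mu>+2) t_1 as 2^(\<mu>+1) (2 t_1) brings the exceptional lift
        into the general form.\<close>
      then have \<delta>': "\<delta>' = \<delta> + int B * int (U_int q S B l \<delta> \<mu> 1 + l ^ (\<mu> + 1) * (2 * t 1))"
        using enat by (simp add: \<delta>'_def \<delta>_def B_def Let_def l2)
      \<comment> \<open>For l = 2 index times order is 1, so the index is 1.\<close>
      have "1 \<in> {1..unit_index l (q ^ card (cyc_coset q B \<delta>))}"
        using index by (auto simp: \<theta> l2)
      from card_cyc_coset_wrong_digit[OF B l(1) lB lq l(2) S less_imp_le[OF \<mu>] this, of "2 * t 1"]
      have "card (cyc_coset q (B * l ^ J) \<delta>') = \<theta> * ord (l ^ (J - \<mu>)) (q ^ \<theta>)"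
        unfolding \<theta> by (subst \<delta>') (simp only:)
      then have "card (cyc_coset q (B * l ^ J) \<delta>') = \<theta> * ord (2 ^ (J - \<mu>)) (q ^ \<theta>)"
        by (simp only: l2)
      also have "ord (2 ^ (J - \<mu>)) (q ^ \<theta>) =
        (if \<mu> = J - 1 then 1 else 2 ^ max 1 (J - \<mu> - multiplicity 2 (q ^ \<theta> + 1)))"
      proof (cases "\<mu> = J - 1")
        case True
        then have "J - \<mu> = 1" using J by simp
        moreover have "[q ^ \<theta> = 1] (mod 2)"
          using lQ unfolding l2 odd_iff_mod_2_eq_one cong_def by (simp only: one_mod_two_eq_one)
        ultimately show ?thesis using True by (simp add: ord_eq_Suc_0_iff)
      next
        case False
        then show ?thesis using \<mu> ord_two_power_3_mod_4[OF Q3, of "J - \<mu>"] by simp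
      qed
      finally show ?thesis
        using enat True k0 by (simp add: Let_def v_exp_def J_def \<theta>_def mult.commute)
    next
      case False
      \<comment> \<open>The primes increase, so 2 can only be the first one; outside the exceptional
        case the odd number q^\<theta> is then 1 modulo 4.\<close>
      have Q4: "[q ^ \<theta> = 1] (mod 4)" if "l = 2"
      proof -
        have "k = 0"
        proof (rule ccontr)
          assume "k \<noteq> 0"
          then have "ps 1 < ps (Suc k)" using k by (intro strict_mono_onD[OF mono]) auto
          moreover have "ps 1 \<ge> 2" using ps[of 1] k prime_ge_2_nat by simp
          ultimately show False using that by (simp add: l_def)
        qed
        then have "q ^ \<theta> mod 4 \<noteq> 3"
          using False that by (simp add: p_exceptional_def l_def cong_def)
        moreover have "odd (q ^ \<theta>)" using lQ unfolding that .
        moreover have "x mod 4 = 1" if "x mod 4 \<noteq> 3" "odd x" for x :: nat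
          using that by presburger
        ultimately have "q ^ \<theta> mod 4 = 1" by blast
        then show ?thesis by (simp add: cong_def)
      qed
      define r where "r = unit_index l (q ^ \<theta>)"
      have r0: "r > 0" using index prime_gt_1_nat[OF l(1)] by (intro Nat.gr0I) (simp add: r_def)
      \<comment> \<open>This exponent from \<open>v_exp\<close> turns its power of q into
        (q^\<theta>)^(ord l (q^\<theta>)), so that \<open>v_exp\<close> is the valuation in
        \<open>ord_prime_power\<close>.\<close>
      have div: "\<theta> * (l - 1) div r = \<theta> * ord l (q ^ \<theta>)"
      proof -
        have "\<theta> * (l - 1) = \<theta> * ord l (q ^ \<theta>) * r"
          unfolding r_def index[symmetric] by (simp only: mult_ac)
        then show ?thesis using r0 by (simp only: nonzero_mult_div_cancel_right)
      qed
      have v: "v_exp q ps (Suc k) \<theta> = multiplicity l ((q ^ \<theta>) ^ ord l (q ^ \<theta>) - 1)"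
        using False div by (simp add: v_exp_def l_def r_def flip: power_mult)
      have "\<not> p_exceptional q ps (Suc k) (card (cyc_coset q N0 \<gamma>))" using False exc by simp
      then have \<delta>': "\<delta>' =
          \<delta> + int B * int (U_int q S B l \<delta> \<mu> (a (Suc k)) + l ^ (\<mu> + 1) * t (Suc k))"
        using enat by (simp add: \<delta>'_def \<delta>_def B_def Let_def l_def)
      have "a (Suc k) \<in> {1..unit_index l (q ^ card (cyc_coset q B \<delta>))}"
        using a_range[OF False] by (simp add: \<theta>)
      from card_cyc_coset_wrong_digit[OF B l(1) lB lq l(2) S less_imp_le[OF \<mu>] this, of "t (Suc k)"]
      have "card (cyc_coset q (B * l ^ J) \<delta>') = \<theta> * ord (l ^ (J - \<mu>)) (q ^ \<theta>)"
        unfolding \<theta> by (subst \<delta>') (simp only:)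
      also have "ord (l ^ (J - \<mu>)) (q ^ \<theta>) =
          l ^ (J - \<mu> - v_exp q ps (Suc k) \<theta>) * ord l (q ^ \<theta>)"
        unfolding v by (rule ord_prime_power[OF l(1) Q1 lQ Q4]) (use \<mu> in auto)
      also have "ord l (q ^ \<theta>) = (l - 1) div r"
        unfolding r_def by (rule ord_eq_div_unit_index[OF l(1) lQ])
      finally show ?thesis
        using enat False by (simp add: Let_def J_def \<theta>_def l_def r_def mult_ac)
    qed
  qed
  moreover have "(\<Prod>i = 1..Suc k. ps i ^ j i) * N0 = B * l ^ J"
    by (simp add: B_def l_def J_def mult_ac)
  ultimately show ?case by (simp only: \<delta>'_def)
qed

section \<open>Specialisation to the base modulus n1 g\<close>

theorem corollary7p4:
  fixes p h q g n n1 u s :: nat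
    and gs e f ps j x :: "nat \<Rightarrow> nat"
    and S :: "nat \<Rightarrow> nat \<Rightarrow> int \<Rightarrow> nat set"
    and m :: "nat \<Rightarrow> enat"
    and a t :: "nat \<Rightarrow> nat"
    and \<gamma> :: int
    and \<tau> :: nat
  assumes "prime p" and "h > 0" and "q = p ^ h"
    and "g > 0" and "g dvd q - 1"
    and "n > 0" and "coprime n q"
    and "g = (\<Prod>k = 1..u. gs k ^ e k)"
    and "n1 = (\<Prod>k = 1..u. gs k ^ f k)"
    and "n = n1 * (\<Prod>k = 1..s. ps k ^ j k)"
    and "\<forall>k\<in>{1..u}. prime (gs k) \<and> gs k \<noteq> p"
    and "\<forall>k\<in>{1..s}. prime (ps k) \<and> ps k \<noteq> p"
    and "gs ` {1..u} \<inter> ps ` {1..s} = {}"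
    and "strict_mono_on {1..u} gs" and "strict_mono_on {1..s} ps"
    and "\<forall>k\<in>{1..u}. e k > 0" and "\<forall>k\<in>{1..s}. j k > 0"
    and "reps_choice p q S"
    and "x \<in> (\<Pi>\<^sub>E k\<in>{1..u}. {0..gs k ^ y_exp q u gs e f k - 1})"
    and "\<gamma> = gamma_x q g u gs f x"
    and "\<tau> = card (cyc_coset q (n1 * g) \<gamma>)"
    and "(m, a, t) \<in> index_set q s ps j \<tau>"
  shows "card (cyc_coset q (n * g) (gamma_seq q S ps j (n1 * g) \<gamma> (m, a, t) s)) =
           tau_seq q ps j \<tau> m s"
proof -
  have n1: "n1 > 0" "coprime n1 q" using assms(6,7,10) by auto
  have "q > 0" using assms(1,3) prime_gt_0_nat by simp
  have cop: "coprime g q"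
  proof (rule coprimeI)
    fix c assume "c dvd g" "c dvd q"
    have "c dvd q - 1" using \<open>c dvd g\<close> assms(5) by (rule dvd_trans)
    with \<open>c dvd q\<close> have "c dvd q - (q - 1)" by (rule dvd_diff_nat)
    then show "is_unit c" using \<open>q > 0\<close> by simp
  qed
  \<comment> \<open>All prime factors of n1 g are among the \<open>gs i\<close>, which are disjoint
    from the \<open>ps k\<close>.\<close>
  have not_dvd: "\<not> ps k dvd n1 * g" if k: "k \<in> {1..s}" for k
  proof
    assume "ps k dvd n1 * g"
    moreover have pk: "prime (ps k)" using assms(12) k by blast
    ultimately have "ps k dvd n1 \<or> ps k dvd g" by (simp add: prime_dvd_mult_iff)
    then have "\<exists>i\<in>{1..u}. ps k dvd gs i ^ e i \<or> ps k dvd gs i ^ f i"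
      unfolding assms(8,9) using pk by (auto simp: prime_dvd_prod_iff)
    then obtain i where i: "i \<in> {1..u}" "ps k dvd gs i"
      using pk prime_dvd_power by blast
    then have "ps k = gs i" using assms(11) pk primes_dvd_imp_eq by blast
    then show False using assms(13) i(1) k by blast
  qed
  have "card (cyc_coset q ((\<Prod>i = 1..s. ps i ^ j i) * (n1 * g))
      (gamma_seq q S ps j (n1 * g) \<gamma> (m, a, t) s)) = tau_seq q ps j \<tau> m s"
  proof (rule card_cyc_coset_gamma_seq[OF assms(1,3,2) _ _ _ assms(15,18,21,22) order_refl])
    show "n1 * g > 0" "coprime (n1 * g) q" using n1 assms(4) cop by simp_all
    show "prime (ps k) \<and> ps k \<noteq> p \<and> \<not> ps k dvd n1 * g \<and> j k > 0"
      if "k \<in> {1..s}" for k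
      using that assms(12,17) not_dvd by blast
  qed
  then show ?thesis by (simp add: assms(10) mult_ac)
qed

end
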